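(* Let $X=f_1e_1+f_2e_2+f_3e_3$ be a vector field on $(H_3,g_3)$, where $f_1,f_2,f_3$ are smooth real functions of $(x,y,z)\in\mathbb{R}^3$. Then $X$ is an affine vector field on $(H_3,g_3)$ if and only if there exist real constants $c_i$, $i\in\{1,\dots,13\}\setminus\{3\}$, such that $$f_1=-\tfrac{c_1}{6}y^4+\tfrac{2c_2-3c_5}{6}y^3+\tfrac{2c_1x+c_4}{2}y^2+(c_1z+c_5x+c_6)y+c_2z+c_7x+c_8,$$ $$\begin{aligned} f_2={}&\left(-\tfrac{c_1}{2}y^2-c_2y+c_9\right)z+\left(-\tfrac{c_1}{2}y^3-\tfrac{c_5+c_2}{2}y^2+(c_9-c_7)y+c_{10}\right)x+\tfrac{c_1}{12}y^5\\ &+\tfrac{3c_5-c_2}{12}y^4+\tfrac{3c_7-3c_4-2c_9}{12}y^3+\tfrac{c_{11}}{2}y^2+c_{12}y+c_{13},\end{aligned}$$ $$\begin{aligned} f_3={}&\left(\tfrac{c_1}{2}y^2+c_2y+c_1-c_9\right)z-\tfrac{c_1}{12}y^5-\tfrac{3c_5-c_2}{12}y^4+\tfrac{-3c_7+3c_4+2c_9-2c_1}{12}y^3\\ &+\left(\tfrac{c_1}{2}y^3+\tfrac{c_2+c_5}{2}y^2+(c_1+c_7-c_9)y+c_5-c_2-c_{10}\right)x+\tfrac{c_2-c_5-c_{11}}{2}y^2\\ &+\tfrac{c_4+c_7-2c_{12}}{2}y+c_{10}+c_{11}+2c_6-c_{13}.\end{aligned}$$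
   Context: The Heisenberg group $H_3$ is $\mathbb{R}^3$ with global coordinates $(x,y,z)$ and multiplication $(x,y,z)(\tilde x,\tilde y,\tilde z)=(x+\tilde x,y+\tilde y,z+\tilde z-x\tilde y)$. The metric $g_3$ is the left-invariant (flat) Lorentzian metric $g_3=dx^2+(x\,dy+dz)^2-((1-x)dy-dz)^2$, with left-invariant orthonormal frame $e_1=\partial_x$, $e_2=\partial_y+(1-x)\partial_z$, $e_3=\partial_y-x\partial_z$ ($e_3$ timelike). A smooth vector field $X$ on a pseudo-Riemannian manifold $(M,g)$ with Levi-Civita connection $\nabla$ is affine if $\mathcal{L}_X\nabla=0$, i.e. $[X,\nabla_YZ]=\nabla_{[X,Y]}Z+\nabla_Y[X,Z]$ for all vector fields $Y,Z$. *)

theory Defs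
  imports "HOL-Analysis.Analysis"
begin

section \<open>Smooth functions and vector fields\<close>

text \<open>A vector field on \<^typ>\<open>'a::euclidean_space\<close> is a function \<^typ>\<open>'a::euclidean_space \<Rightarrow> 'a\<close>;
  its value at a point collects the components with respect to the global coordinate
  vector fields.\<close>

primrec nsmooth :: "nat \<Rightarrow> ('a::euclidean_space \<Rightarrow> 'b::real_normed_vector) \<Rightarrow> bool" where
  "nsmooth 0 f \<longleftrightarrow> continuous_on UNIV f"
| "nsmooth (Suc n) f \<longleftrightarrow>
     (\<forall>p. f differentiable (at p)) \<and> (\<forall>v. nsmooth n (\<lambda>p. frechet_derivative f (at p) v))"

definition smooth :: "('a::euclidean_space \<Rightarrow> 'b::real_normed_vector) \<Rightarrow> bool" where
  "smooth f \<longleftrightarrow> (\<forall>n. nsmooth n f)"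

text \<open>For real-valued \<open>f\<close> this is the function \<open>X f\<close>; for a vector field \<open>f\<close> it
  differentiates the components.\<close>

definition dirderiv ::
  "('a::euclidean_space \<Rightarrow> 'a) \<Rightarrow> ('a \<Rightarrow> 'b::real_normed_vector) \<Rightarrow> 'a \<Rightarrow> 'b" where
  "dirderiv X f p = frechet_derivative f (at p) (X p)"

definition lie_bracket ::
  "('a::euclidean_space \<Rightarrow> 'a) \<Rightarrow> ('a \<Rightarrow> 'a) \<Rightarrow> 'a \<Rightarrow> 'a" where
  "lie_bracket X Y p = dirderiv X Y p - dirderiv Y X p"

section \<open>Levi-Civita connection and affine vector fields\<close>

text \<open>The values of \<open>D\<close> on fields that are not smooth are irrelevant: every condition below
  is restricted to smooth fields.\<close>

definition affine_connection ::
  "(('a::euclidean_space \<Rightarrow> 'a) \<Rightarrow> ('a \<Rightarrow> 'a) \<Rightarrow> 'a \<Rightarrow> 'a) \<Rightarrow> bool" where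
  "affine_connection D \<longleftrightarrow>
     (\<forall>X Y. smooth X \<longrightarrow> smooth Y \<longrightarrow> smooth (D X Y)) \<and>
     (\<forall>X X' Y. smooth X \<longrightarrow> smooth X' \<longrightarrow> smooth Y \<longrightarrow>
        D (\<lambda>p. X p + X' p) Y = (\<lambda>p. D X Y p + D X' Y p)) \<and>
     (\<forall>(f :: 'a \<Rightarrow> real) X Y. smooth f \<longrightarrow> smooth X \<longrightarrow> smooth Y \<longrightarrow>
        D (\<lambda>p. f p *\<^sub>R X p) Y = (\<lambda>p. f p *\<^sub>R D X Y p)) \<and>
     (\<forall>X Y Y'. smooth X \<longrightarrow> smooth Y \<longrightarrow> smooth Y' \<longrightarrow>
        D X (\<lambda>p. Y p + Y' p) = (\<lambda>p. D X Y p + D X Y' p)) \<and>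
     (\<forall>(f :: 'a \<Rightarrow> real) X Y. smooth f \<longrightarrow> smooth X \<longrightarrow> smooth Y \<longrightarrow>
        D X (\<lambda>p. f p *\<^sub>R Y p) = (\<lambda>p. dirderiv X f p *\<^sub>R Y p + f p *\<^sub>R D X Y p))"

definition torsion_free ::
  "(('a::euclidean_space \<Rightarrow> 'a) \<Rightarrow> ('a \<Rightarrow> 'a) \<Rightarrow> 'a \<Rightarrow> 'a) \<Rightarrow> bool" where
  "torsion_free D \<longleftrightarrow>
     (\<forall>X Y. smooth X \<longrightarrow> smooth Y \<longrightarrow> (\<lambda>p. D X Y p - D Y X p) = lie_bracket X Y)"

definition metric_compatible ::
  "('a::euclidean_space \<Rightarrow> 'a \<Rightarrow> 'a \<Rightarrow> real) \<Rightarrow>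
   (('a \<Rightarrow> 'a) \<Rightarrow> ('a \<Rightarrow> 'a) \<Rightarrow> 'a \<Rightarrow> 'a) \<Rightarrow> bool" where
  "metric_compatible g D \<longleftrightarrow>
     (\<forall>X Y Z. smooth X \<longrightarrow> smooth Y \<longrightarrow> smooth Z \<longrightarrow>
        dirderiv X (\<lambda>p. g p (Y p) (Z p)) =
        (\<lambda>p. g p (D X Y p) (Z p) + g p (Y p) (D X Z p)))"

definition levi_civita ::
  "('a::euclidean_space \<Rightarrow> 'a \<Rightarrow> 'a \<Rightarrow> real) \<Rightarrow>
   (('a \<Rightarrow> 'a) \<Rightarrow> ('a \<Rightarrow> 'a) \<Rightarrow> 'a \<Rightarrow> 'a) \<Rightarrow> bool" where
  "levi_civita g D \<longleftrightarrow> affine_connection D \<and> torsion_free D \<and> metric_compatible g D"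

definition affine_vector_field ::
  "(('a::euclidean_space \<Rightarrow> 'a) \<Rightarrow> ('a \<Rightarrow> 'a) \<Rightarrow> 'a \<Rightarrow> 'a) \<Rightarrow> ('a \<Rightarrow> 'a) \<Rightarrow> bool" where
  "affine_vector_field D X \<longleftrightarrow> smooth X \<and>
     (\<forall>Y Z. smooth Y \<longrightarrow> smooth Z \<longrightarrow>
        lie_bracket X (D Y Z) =
        (\<lambda>p. D (lie_bracket X Y) Z p + D Y (lie_bracket X Z) p))"

section \<open>The Heisenberg group with its flat Lorentzian metric\<close>

type_synonym heisenberg = "real^3"

definition heis_mult :: "heisenberg \<Rightarrow> heisenberg \<Rightarrow> heisenberg" where
  "heis_mult p q = vector [p$1 + q$1, p$2 + q$2, p$3 + q$3 - p$1 * q$2]"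

text \<open>The polarisation of \<open>dx\<^sup>2 + (x dy + dz)\<^sup>2 - ((1 - x) dy - dz)\<^sup>2\<close> at the point
  \<open>p = (x, y, z)\<close>.\<close>

definition g3 :: "heisenberg \<Rightarrow> heisenberg \<Rightarrow> heisenberg \<Rightarrow> real" where
  "g3 p u v = u$1 * v$1 + (p$1 * u$2 + u$3) * (p$1 * v$2 + v$3)
              - ((1 - p$1) * u$2 - u$3) * ((1 - p$1) * v$2 - v$3)"

definition e1 :: "heisenberg \<Rightarrow> heisenberg" where "e1 p = vector [1, 0, 0]"
definition e2 :: "heisenberg \<Rightarrow> heisenberg" where "e2 p = vector [0, 1, 1 - p$1]"
definition e3 :: "heisenberg \<Rightarrow> heisenberg" where "e3 p = vector [0, 1, - p$1]"

lemma g3_orthonormal: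
  "g3 p (e1 p) (e1 p) = 1" "g3 p (e2 p) (e2 p) = 1" "g3 p (e3 p) (e3 p) = -1"
  "g3 p (e1 p) (e2 p) = 0" "g3 p (e1 p) (e3 p) = 0" "g3 p (e2 p) (e3 p) = 0"
  by (simp_all add: g3_def e1_def e2_def e3_def)

lemma has_derivative_heis_mult:
  "(heis_mult a has_derivative (\<lambda>u. vector [u$1, u$2, u$3 - a$1 * u$2])) (at p)"
proof -
  have lin: "linear (\<lambda>u::real^3. vector [u$1, u$2, u$3 - a$1 * u$2] :: real^3)"
    by (rule linearI) (simp_all add: vec_eq_iff forall_3 algebra_simps)
  have eq: "heis_mult a = (\<lambda>u. a + vector [u$1, u$2, u$3 - a$1 * u$2])"
    by (auto simp: heis_mult_def fun_eq_iff vec_eq_iff forall_3)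
  show ?thesis
    unfolding eq
    by (auto intro!: derivative_eq_intros
        linear_imp_has_derivative[OF lin])
qed

lemma g3_left_invariant:
  "g3 (heis_mult a p) (frechet_derivative (heis_mult a) (at p) u)
      (frechet_derivative (heis_mult a) (at p) v) = g3 p u v"
  unfolding frechet_derivative_at[OF has_derivative_heis_mult, symmetric]
  by (simp add: g3_def heis_mult_def algebra_simps)

lemma frame_left_invariant:
  "frechet_derivative (heis_mult a) (at p) (e1 p) = e1 (heis_mult a p)"
  "frechet_derivative (heis_mult a) (at p) (e2 p) = e2 (heis_mult a p)"
  "frechet_derivative (heis_mult a) (at p) (e3 p) = e3 (heis_mult a p)"
  unfolding frechet_derivative_at[OF has_derivative_heis_mult, symmetric]
  by (simp_all add: heis_mult_def e1_def e2_def e3_def vec_eq_iff forall_3)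

section \<open>Existence of the Levi-Civita connection of \<open>g3\<close>\<close>

lemma nsmooth_continuous: "nsmooth n f \<Longrightarrow> continuous_on UNIV f"
  by (cases n) (auto intro!: continuous_at_imp_continuous_on differentiable_imp_continuous_within)

lemma nsmooth_SucD: "nsmooth (Suc n) f \<Longrightarrow> nsmooth n f"
proof (induction n arbitrary: f)
  case 0
  then show ?case using nsmooth_continuous[of "Suc 0" f] by simp
next
  case (Suc n)
  from Suc.prems have "f differentiable (at p)" for p by simp
  moreover have "nsmooth n (\<lambda>p. frechet_derivative f (at p) v)" for v
    using Suc.prems by (intro Suc.IH) auto
  ultimately show ?case by simp
qed

lemma smooth_differentiable: "smooth f \<Longrightarrow> f differentiable (at p)"
  unfolding smooth_def by (metis nsmooth.simps(2))

lemma smooth_has_derivative: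
  "smooth f \<Longrightarrow> (f has_derivative frechet_derivative f (at p)) (at p)"
  using smooth_differentiable frechet_derivative_works by blast

lemma smooth_frechet_derivative: "smooth f \<Longrightarrow> smooth (\<lambda>p. frechet_derivative f (at p) v)"
  unfolding smooth_def by (metis nsmooth.simps(2))

lemma nsmooth_const: "nsmooth n (\<lambda>p. c)"
  by (induction n arbitrary: c) (auto simp: continuous_on_const)

lemma nsmooth_add:
  "nsmooth n f \<Longrightarrow> nsmooth n g \<Longrightarrow> nsmooth n (\<lambda>p. f p + g p)"
proof (induction n arbitrary: f g)
  case 0
  then show ?case by (auto intro: continuous_on_add)
next
  case (Suc n)
  have d: "f differentiable (at p)" "g differentiable (at p)" for p
    using Suc.prems by auto
  have eq: "(\<lambda>p. frechet_derivative (\<lambda>p. f p + g p) (at p) v) =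
        (\<lambda>p. frechet_derivative f (at p) v + frechet_derivative g (at p) v)" for v
  proof
    fix p
    have "((\<lambda>p. f p + g p) has_derivative
            (\<lambda>v. frechet_derivative f (at p) v + frechet_derivative g (at p) v)) (at p)"
      using d by (auto intro!: has_derivative_add simp flip: frechet_derivative_works)
    from frechet_derivative_at[OF this, symmetric]
    show "frechet_derivative (\<lambda>p. f p + g p) (at p) v =
        frechet_derivative f (at p) v + frechet_derivative g (at p) v" by simp
  qed
  show ?case
    using d Suc.prems by (auto simp: eq intro!: Suc.IH differentiable_add)
qed

lemma nsmooth_bilinear:
  assumes "bounded_bilinear B"
  shows "nsmooth n f \<Longrightarrow> nsmooth n g \<Longrightarrow> nsmooth n (\<lambda>p. B (f p) (g p))"
proof (induction n arbitrary: f g)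
  case 0
  then show ?case using bounded_bilinear.continuous_on[OF assms] by auto
next
  case (Suc n)
  have d: "f differentiable (at p)" "g differentiable (at p)" for p
    using Suc.prems by auto
  have hd: "((\<lambda>p. B (f p) (g p)) has_derivative
            (\<lambda>v. B (f p) (frechet_derivative g (at p) v) +
                 B (frechet_derivative f (at p) v) (g p))) (at p)" for p
    using d by (auto intro!: bounded_bilinear.FDERIV[OF assms] simp flip: frechet_derivative_works)
  have eq: "(\<lambda>p. frechet_derivative (\<lambda>p. B (f p) (g p)) (at p) v) =
        (\<lambda>p. B (f p) (frechet_derivative g (at p) v) +
             B (frechet_derivative f (at p) v) (g p))" for v
    by (rule ext) (simp add: frechet_derivative_at[OF hd, symmetric])
  have "nsmooth n f" "nsmooth n g" using Suc.prems nsmooth_SucD by blast+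
  then show ?case
    using Suc.prems hd by (auto simp: eq differentiable_def intro!: Suc.IH nsmooth_add)
qed

lemma smooth_const: "smooth (\<lambda>p. c)"
  by (simp add: smooth_def nsmooth_const)

lemma smooth_add: "smooth f \<Longrightarrow> smooth g \<Longrightarrow> smooth (\<lambda>p. f p + g p)"
  by (simp add: smooth_def nsmooth_add)

lemma smooth_bilinear:
  "bounded_bilinear B \<Longrightarrow> smooth f \<Longrightarrow> smooth g \<Longrightarrow> smooth (\<lambda>p. B (f p) (g p))"
  by (simp add: smooth_def nsmooth_bilinear)

lemma smooth_sum: "(\<And>i. i \<in> I \<Longrightarrow> smooth (f i)) \<Longrightarrow> smooth (\<lambda>p. \<Sum>i\<in>I. f i p)"
  by (induction I rule: infinite_finite_induct) (auto intro: smooth_const smooth_add)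

lemma smooth_dirderiv:
  assumes "smooth X" "smooth f"
  shows "smooth (dirderiv X f)"
proof -
  have "dirderiv X f p = (\<Sum>b\<in>Basis. (X p \<bullet> b) *\<^sub>R frechet_derivative f (at p) b)" for p
  proof -
    interpret linear "frechet_derivative f (at p)"
      by (rule has_derivative_linear[OF smooth_has_derivative[OF assms(2)]])
    have "dirderiv X f p = frechet_derivative f (at p) (\<Sum>b\<in>Basis. (X p \<bullet> b) *\<^sub>R b)"
      by (simp add: dirderiv_def euclidean_representation)
    then show ?thesis by (simp add: sum scale)
  qed
  then have "dirderiv X f =
      (\<lambda>p. \<Sum>b\<in>Basis. (X p \<bullet> b) *\<^sub>R frechet_derivative f (at p) b)" ..
  moreover have "smooth \<dots>"
    by (intro smooth_sum smooth_bilinear[OF bounded_bilinear_scaleR]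
        smooth_bilinear[OF bounded_bilinear_inner] smooth_const smooth_frechet_derivative assms)
  ultimately show ?thesis by simp
qed

definition christoffel3 :: "heisenberg \<Rightarrow> heisenberg \<Rightarrow> heisenberg" where
  "christoffel3 u v = vector [- u$2 * v$2, 0, u$1 * v$2 + u$2 * v$1]"

lemma bounded_bilinear_christoffel3: "bounded_bilinear christoffel3"
  unfolding bilinear_conv_bounded_bilinear[symmetric] bilinear_def
  by (auto intro!: linearI simp: christoffel3_def vec_eq_iff forall_3 algebra_simps)

theorem levi_civita_g3_exists: "\<exists>D. levi_civita g3 D"
proof
  let ?D = "\<lambda>X Y p. dirderiv X Y p + christoffel3 (X p) (Y p)"
  interpret C: bounded_bilinear christoffel3 by (rule bounded_bilinear_christoffel3)
  have "affine_connection ?D"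
    unfolding affine_connection_def
  proof (intro conjI allI impI)
    fix X Y :: "heisenberg \<Rightarrow> heisenberg"
    assume "smooth X" "smooth Y"
    then show "smooth (?D X Y)"
      by (intro smooth_add smooth_dirderiv smooth_bilinear[OF bounded_bilinear_christoffel3])
  next
    fix X X' Y :: "heisenberg \<Rightarrow> heisenberg"
    assume s: "smooth X" "smooth X'" "smooth Y"
    show "?D (\<lambda>p. X p + X' p) Y = (\<lambda>p. ?D X Y p + ?D X' Y p)"
      using linear_add[OF has_derivative_linear[OF smooth_has_derivative[OF s(3)]]]
      by (auto simp: dirderiv_def C.add_left)
  next
    fix f :: "heisenberg \<Rightarrow> real" and X Y :: "heisenberg \<Rightarrow> heisenberg"
    assume s: "smooth f" "smooth X" "smooth Y"
    show "?D (\<lambda>p. f p *\<^sub>R X p) Y = (\<lambda>p. f p *\<^sub>R ?D X Y p)"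
      using linear_scale[OF has_derivative_linear[OF smooth_has_derivative[OF s(3)]]]
      by (auto simp: dirderiv_def C.scaleR_left scaleR_add_right)
  next
    fix X Y Y' :: "heisenberg \<Rightarrow> heisenberg"
    assume s: "smooth X" "smooth Y" "smooth Y'"
    show "?D X (\<lambda>p. Y p + Y' p) = (\<lambda>p. ?D X Y p + ?D X Y' p)"
      using frechet_derivative_at[OF has_derivative_add[OF smooth_has_derivative[OF s(2)]
          smooth_has_derivative[OF s(3)]], symmetric]
      by (auto simp: dirderiv_def C.add_right)
  next
    fix f :: "heisenberg \<Rightarrow> real" and X Y :: "heisenberg \<Rightarrow> heisenberg"
    assume s: "smooth f" "smooth X" "smooth Y"
    show "?D X (\<lambda>p. f p *\<^sub>R Y p) =
        (\<lambda>p. dirderiv X f p *\<^sub>R Y p + f p *\<^sub>R ?D X Y p)"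
      using frechet_derivative_at[OF has_derivative_scaleR[OF smooth_has_derivative[OF s(1)]
          smooth_has_derivative[OF s(3)]], symmetric]
      by (auto simp: dirderiv_def C.scaleR_right scaleR_add_right)
  qed
  moreover have "torsion_free ?D"
    unfolding torsion_free_def
    by (auto simp: lie_bracket_def christoffel3_def fun_eq_iff vec_eq_iff forall_3)
  moreover have "metric_compatible g3 ?D"
    unfolding metric_compatible_def
  proof (intro allI impI ext)
    fix X Y Z :: "heisenberg \<Rightarrow> heisenberg" and p
    assume s: "smooth X" "smooth Y" "smooth Z"
    let ?Y = "frechet_derivative Y (at p)" and ?Z = "frechet_derivative Z (at p)"
    have c: "((\<lambda>q. Y q $ i) has_derivative (\<lambda>u. ?Y u $ i)) (at p)"
            "((\<lambda>q. Z q $ i) has_derivative (\<lambda>u. ?Z u $ i)) (at p)"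
            "((\<lambda>q. q $ i) has_derivative (\<lambda>u. u $ i)) (at p)" for i
      using s by (auto intro!: bounded_linear.has_derivative[OF bounded_linear_vec_nth]
          smooth_has_derivative bounded_linear_imp_has_derivative)
    have g: "g3 q u v = u$1 * v$1 + (2 * q$1 - 1) * (u$2 * v$2) + u$2 * v$3 + u$3 * v$2"
      for q u v by (simp add: g3_def algebra_simps)
    have "((\<lambda>q. g3 q (Y q) (Z q)) has_derivative
        (\<lambda>u. ?Y u$1 * Z p$1 + Y p$1 * ?Z u$1 + 2 * u$1 * (Y p$2 * Z p$2)
           + (2 * p$1 - 1) * (?Y u$2 * Z p$2 + Y p$2 * ?Z u$2)
           + ?Y u$2 * Z p$3 + Y p$2 * ?Z u$3 + ?Y u$3 * Z p$2 + Y p$3 * ?Z u$2)) (at p)"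
      unfolding g by (auto intro!: derivative_eq_intros c simp: algebra_simps)
    from frechet_derivative_at[OF this, symmetric]
    show "dirderiv X (\<lambda>p. g3 p (Y p) (Z p)) p =
        g3 p (?D X Y p) (Z p) + g3 p (Y p) (?D X Z p)"
      by (simp add: dirderiv_def g christoffel3_def algebra_simps)
  qed
  ultimately show "levi_civita g3 ?D" by (simp add: levi_civita_def)
qed

end

theory Submission
  imports Defs
begin

text \<open>The metric is flat: the global chart \<open>T = (x - y\<^sup>2/2, y, z + x y - y\<^sup>3/6)\<close> pulls the constant
  form \<open>dU\<^sup>2 - dV\<^sup>2 + 2 dV dW\<close> back to \<open>g3\<close>. Hence \<open>(\<nabla>\<^sub>Y Z) T = Y (Z T)\<close> for the Levi-Civita
  connection, and \<open>X\<close> is affine iff \<open>(\<nabla>\<^sub>Y Z) (X T) = Y (Z (X T))\<close> for all \<open>Y\<close> and \<open>Z\<close>. Testing on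
  the coordinate fields of the chart, this says that the second derivatives of \<open>X T\<close> in the chart vanish, that is,
  \<open>X T\<close> is an affine function of \<open>T\<close>. The constants \<open>c\<^sub>i\<close> parametrise these twelve-dimensional
  affine functions.\<close>

section \<open>Smooth functions and iterated directional derivatives\<close>

lemma smooth_line_derivative:
  fixes F :: "'a::euclidean_space \<Rightarrow> real"
  assumes "smooth F"
  shows "((\<lambda>s. F (q + s *\<^sub>R v)) has_real_derivative frechet_derivative F (at (q + s *\<^sub>R v)) v) (at s)"
proof -
  have "((\<lambda>s. F (q + s *\<^sub>R v)) has_derivative (\<lambda>h. frechet_derivative F (at (q + s *\<^sub>R v)) (h *\<^sub>R v))) (at s)"
    by (rule has_derivative_compose[of "\<lambda>s. q + s *\<^sub>R v" _ _ _ F, OF _ smooth_has_derivative[OF assms]])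
      (auto intro!: derivative_eq_intros)
  moreover have "frechet_derivative F (at (q + s *\<^sub>R v)) (h *\<^sub>R v) = frechet_derivative F (at (q + s *\<^sub>R v)) v * h" for h
    by (simp add: linear_scale[OF has_derivative_linear[OF smooth_has_derivative[OF assms]]])
  ultimately show ?thesis
    by (simp add: has_field_derivative_def)
qed

text \<open>The mean value theorem is used twice: along \<open>v\<close> for the difference of
  \<open>F\<close> on two segments that are \<open>h *\<^sub>R w\<close> apart, then along
  \<open>w\<close> for the \<open>v\<close>-derivative of \<open>F\<close>. The second difference on
  the left is symmetric in \<open>v\<close> and \<open>w\<close>, so swapping them yields the other
  mixed derivative.\<close>

lemma second_difference_mean_value:
  fixes F :: "'a::euclidean_space \<Rightarrow> real"
  assumes F: "smooth F" and h: "0 < h"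
  obtains s t where "0 < s" "s < h" "0 < t" "t < h"
    "F (p + h *\<^sub>R v + h *\<^sub>R w) - F (p + h *\<^sub>R v) - F (p + h *\<^sub>R w) + F p =
       h * h * frechet_derivative (\<lambda>q. frechet_derivative F (at q) v) (at (p + s *\<^sub>R v + t *\<^sub>R w)) w"
proof -
  let ?G = "\<lambda>q. frechet_derivative F (at q) v"
  have "((\<lambda>s. F (p + h *\<^sub>R w + s *\<^sub>R v) - F (p + s *\<^sub>R v)) has_real_derivative
      ?G (p + h *\<^sub>R w + s *\<^sub>R v) - ?G (p + s *\<^sub>R v)) (at s)" for s
    by (intro DERIV_diff smooth_line_derivative F)
  from MVT2[OF h this] obtain s where s: "0 < s" "s < h"
    "F (p + h *\<^sub>R w + h *\<^sub>R v) - F (p + h *\<^sub>R v) - (F (p + h *\<^sub>R w) - F p) =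
       h * (?G (p + h *\<^sub>R w + s *\<^sub>R v) - ?G (p + s *\<^sub>R v))"
    by auto
  from MVT2[OF h smooth_line_derivative[OF smooth_frechet_derivative[OF F], of "p + s *\<^sub>R v" w v]]
  obtain t where t: "0 < t" "t < h"
    "?G (p + s *\<^sub>R v + h *\<^sub>R w) - ?G (p + s *\<^sub>R v) =
       h * frechet_derivative ?G (at (p + s *\<^sub>R v + t *\<^sub>R w)) w"
    by auto
  show ?thesis
    using that[OF s(1,2) t(1,2)] s(3) t(3) by (simp add: ac_simps)
qed

text \<open>Each mixed derivative, at a suitable point near \<open>p\<close>, equals the same second
  difference divided by \<open>h * h\<close>. Both are continuous, so they agree at
  \<open>p\<close>.\<close>

lemma second_derivative_symmetric_real:
  fixes F :: "'a::euclidean_space \<Rightarrow> real"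
  assumes F: "smooth F"
  shows "frechet_derivative (\<lambda>q. frechet_derivative F (at q) v) (at p) w =
         frechet_derivative (\<lambda>q. frechet_derivative F (at q) w) (at p) v"
proof (rule ccontr)
  define G where "G v w q = frechet_derivative (\<lambda>q. frechet_derivative F (at q) v) (at q) w" for v w q
  assume "\<not> ?thesis"
  \<comment> \<open>\<open>?e\<close> is half of the supposed gap, so values closer than
    \<open>?e\<close> to \<open>G v w p\<close> and to \<open>G w v p\<close> respectively cannot
    coincide.\<close>
  then have e: "\<bar>G v w p - G w v p\<bar> / 2 > 0" (is "?e > 0")
    by (simp add: G_def)
  have "isCont (G v w) p" for v w
    using smooth_differentiable[OF smooth_frechet_derivative[OF smooth_frechet_derivative[OF F]]]
      differentiable_imp_continuous_within
    unfolding G_def by blast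
  then have "\<exists>d>0. \<forall>q. dist q p < d \<longrightarrow> dist (G v w q) (G v w p) < ?e" for v w
    using e unfolding continuous_at_eps_delta by blast
  then obtain d d' where d: "d > 0" "\<And>q. dist q p < d \<Longrightarrow> dist (G v w q) (G v w p) < ?e"
    and d': "d' > 0" "\<And>q. dist q p < d' \<Longrightarrow> dist (G w v q) (G w v p) < ?e"
    by metis
  \<comment> \<open>This \<open>h\<close> keeps the intermediate points of both second differences
    within the two radii of continuity; the summand \<open>1\<close> keeps the denominator positive
    when \<open>v\<close> and \<open>w\<close> vanish.\<close>
  define h where "h = min d d' / (norm v + norm w + 1)"
  have nz: "norm v + norm w + 1 > 0"
    by (simp add: add_nonneg_pos)
  have h: "h > 0" "h * (norm v + norm w + 1) = min d d'"
    using d(1) d'(1) nz by (auto simp: h_def)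
  have close: "dist (p + s *\<^sub>R a + t *\<^sub>R b) p < min d d'"
    if st: "0 < s" "s < h" "0 < t" "t < h" and ab: "a = v \<and> b = w \<or> a = w \<and> b = v" for s t a b
  proof -
    have "dist (p + s *\<^sub>R a + t *\<^sub>R b) p = norm (s *\<^sub>R a + t *\<^sub>R b)"
      by (simp add: dist_norm add.assoc)
    also have "\<dots> \<le> s * norm a + t * norm b"
      using norm_triangle_ineq[of "s *\<^sub>R a" "t *\<^sub>R b"] st by simp
    also have "\<dots> \<le> h * norm a + h * norm b"
      using st by (intro add_mono mult_right_mono) auto
    also have "\<dots> = h * (norm v + norm w)"
      using ab by (auto simp: algebra_simps)
    also have "\<dots> < min d d'"
      using h unfolding distrib_left mult_1_right by linarith
    finally show ?thesis .
  qed
  obtain s t where 1: "0 < s" "s < h" "0 < t" "t < h"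
    "F (p + h *\<^sub>R v + h *\<^sub>R w) - F (p + h *\<^sub>R v) - F (p + h *\<^sub>R w) + F p =
       h * h * G v w (p + s *\<^sub>R v + t *\<^sub>R w)"
    unfolding G_def by (rule second_difference_mean_value[OF F h(1)])
  obtain s' t' where 2: "0 < s'" "s' < h" "0 < t'" "t' < h"
    "F (p + h *\<^sub>R w + h *\<^sub>R v) - F (p + h *\<^sub>R w) - F (p + h *\<^sub>R v) + F p =
       h * h * G w v (p + s' *\<^sub>R w + t' *\<^sub>R v)"
    unfolding G_def by (rule second_difference_mean_value[OF F h(1)])
  have "h * h * G v w (p + s *\<^sub>R v + t *\<^sub>R w) = h * h * G w v (p + s' *\<^sub>R w + t' *\<^sub>R v)"
    unfolding 1(5)[symmetric] 2(5)[symmetric] by (simp add: ac_simps)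
  then have "G v w (p + s *\<^sub>R v + t *\<^sub>R w) = G w v (p + s' *\<^sub>R w + t' *\<^sub>R v)"
    using h(1) by simp
  moreover have "dist (G v w (p + s *\<^sub>R v + t *\<^sub>R w)) (G v w p) < ?e"
    using close[OF 1(1-4)] by (intro d(2)) auto
  moreover have "dist (G w v (p + s' *\<^sub>R w + t' *\<^sub>R v)) (G w v p) < ?e"
    using close[OF 2(1-4)] by (intro d'(2)) auto
  ultimately show False
    by (simp add: dist_real_def abs_if split: if_splits)
qed

lemma frechet_derivative_inner_left:
  "smooth f \<Longrightarrow> frechet_derivative (\<lambda>q. f q \<bullet> u) (at p) v = frechet_derivative f (at p) v \<bullet> u"
  using frechet_derivative_at[OF bounded_linear.has_derivative[OF bounded_linear_inner_left
        smooth_has_derivative[of f p]], of u, symmetric]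
  by simp

lemma second_derivative_symmetric:
  fixes f :: "'a::euclidean_space \<Rightarrow> 'b::euclidean_space"
  assumes f: "smooth f"
  shows "frechet_derivative (\<lambda>q. frechet_derivative f (at q) v) (at p) w =
         frechet_derivative (\<lambda>q. frechet_derivative f (at q) w) (at p) v" (is "?l = ?r")
proof (rule euclidean_eqI)
  fix u :: 'b
  have "smooth (\<lambda>q. f q \<bullet> u)"
    by (intro smooth_bilinear[OF bounded_bilinear_inner] f smooth_const)
  from second_derivative_symmetric_real[OF this, of v p w] show "?l \<bullet> u = ?r \<bullet> u"
    by (simp add: frechet_derivative_inner_left f smooth_frechet_derivative)
qed

section \<open>Iterated derivatives along fields and Lie brackets\<close>

lemma linear_frechet_derivative: "smooth f \<Longrightarrow> linear (frechet_derivative f (at p))"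
  by (rule has_derivative_linear[OF smooth_has_derivative])

text \<open>Product rule: in a basis, \<open>dirderiv X f\<close> is a finite sum of components of
  \<open>X\<close> times derivatives of \<open>f\<close> in fixed directions. The second summand
  collects the terms in which the direction stays frozen at \<open>X p\<close>.\<close>

lemma has_derivative_dirderiv:
  assumes X: "smooth X" and f: "smooth f"
  shows "(dirderiv X f has_derivative (\<lambda>u. frechet_derivative f (at p) (frechet_derivative X (at p) u)
     + frechet_derivative (\<lambda>q. frechet_derivative f (at q) (X p)) (at p) u)) (at p)"
proof -
  have lin: "frechet_derivative f (at q) v = (\<Sum>b\<in>Basis. (v \<bullet> b) *\<^sub>R frechet_derivative f (at q) b)" for q v
  proof -
    interpret linear "frechet_derivative f (at q)"
      by (rule linear_frechet_derivative[OF f])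
    show ?thesis
      by (subst euclidean_representation[of v, symmetric]) (simp only: sum scale)
  qed
  have fb: "((\<lambda>q. frechet_derivative f (at q) b) has_derivative
      frechet_derivative (\<lambda>q. frechet_derivative f (at q) b) (at p)) (at p)" for b
    by (rule smooth_has_derivative[OF smooth_frechet_derivative[OF f]])
  have X': "(X has_derivative frechet_derivative X (at p)) (at p)"
    by (rule smooth_has_derivative[OF X])
  have "((\<lambda>q. \<Sum>b\<in>Basis. (X p \<bullet> b) *\<^sub>R frechet_derivative f (at q) b) has_derivative
      (\<lambda>u. \<Sum>b\<in>Basis. (X p \<bullet> b) *\<^sub>R frechet_derivative (\<lambda>q. frechet_derivative f (at q) b) (at p) u)) (at p)"
    by (intro has_derivative_sum has_derivative_scaleR_right fb)
  then have second: "frechet_derivative (\<lambda>q. frechet_derivative f (at q) (X p)) (at p) =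
      (\<lambda>u. \<Sum>b\<in>Basis. (X p \<bullet> b) *\<^sub>R frechet_derivative (\<lambda>q. frechet_derivative f (at q) b) (at p) u)"
    unfolding lin[symmetric] by (rule frechet_derivative_at[symmetric])
  have "dirderiv X f = (\<lambda>q. \<Sum>b\<in>Basis. (X q \<bullet> b) *\<^sub>R frechet_derivative f (at q) b)"
    by (rule ext) (simp only: dirderiv_def lin[symmetric])
  moreover have "(\<dots> has_derivative (\<lambda>u. \<Sum>b\<in>Basis.
      (X p \<bullet> b) *\<^sub>R frechet_derivative (\<lambda>q. frechet_derivative f (at q) b) (at p) u +
      (frechet_derivative X (at p) u \<bullet> b) *\<^sub>R frechet_derivative f (at p) b)) (at p)"
    by (intro has_derivative_sum has_derivative_scaleR has_derivative_inner_left X' fb)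
  ultimately show ?thesis
    by (simp only: second sum.distrib lin[symmetric] add.commute)
qed

lemma dirderiv_dirderiv:
  assumes "smooth X" "smooth f"
  shows "dirderiv Y (dirderiv X f) p = frechet_derivative f (at p) (dirderiv Y X p)
     + frechet_derivative (\<lambda>q. frechet_derivative f (at q) (X p)) (at p) (Y p)"
  using frechet_derivative_at[OF has_derivative_dirderiv[OF assms], symmetric]
  by (simp add: dirderiv_def)

lemma dirderiv_diff:
  assumes "smooth f" "smooth g"
  shows "dirderiv X (\<lambda>p. f p - g p) p = dirderiv X f p - dirderiv X g p"
  using frechet_derivative_at[OF has_derivative_diff[OF smooth_has_derivative[OF assms(1)]
        smooth_has_derivative[OF assms(2)]], symmetric]
  by (simp add: dirderiv_def)

text \<open>The second-order terms of the two iterated derivatives cancel by symmetry of the second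
  derivative of \<open>f\<close>; the first-order terms make up the bracket.\<close>

lemma dirderiv_lie_bracket:
  fixes f :: "'a::euclidean_space \<Rightarrow> 'b::euclidean_space"
  assumes "smooth X" "smooth Y" "smooth f"
  shows "dirderiv (lie_bracket X Y) f =
    (\<lambda>p. dirderiv X (dirderiv Y f) p - dirderiv Y (dirderiv X f) p)"
proof
  fix p
  show "dirderiv (lie_bracket X Y) f p = dirderiv X (dirderiv Y f) p - dirderiv Y (dirderiv X f) p"
    using second_derivative_symmetric[OF assms(3), of "X p" p "Y p"]
    by (simp add: dirderiv_dirderiv assms)
      (simp add: dirderiv_def[of "lie_bracket X Y"] lie_bracket_def
        linear_diff[OF linear_frechet_derivative[OF assms(3)]])
qed

lemma smooth_diff:
  assumes "smooth f" "smooth g"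
  shows "smooth (\<lambda>p. f p - g p)"
  using smooth_add[OF assms(1) smooth_bilinear[OF bounded_bilinear_scaleR smooth_const[of "-1"] assms(2)]]
  by simp

lemma smooth_minus:
  assumes "smooth f"
  shows "smooth (\<lambda>p. - f p)"
  using smooth_diff[OF smooth_const[of 0] assms] by simp

lemma smooth_lie_bracket: "smooth X \<Longrightarrow> smooth Y \<Longrightarrow> smooth (lie_bracket X Y)"
  unfolding lie_bracket_def [abs_def] by (intro smooth_diff smooth_dirderiv)

lemma frechet_derivative_zero_constant:
  assumes "smooth f" "\<And>p u. frechet_derivative f (at p) u = 0"
  shows "f p = f q"
proof (rule has_derivative_zero_unique[of UNIV f])
  show "(f has_derivative (\<lambda>h. 0)) (at x within UNIV)" for x
    using smooth_has_derivative[OF assms(1), of x] unfolding assms(2)[of x, THEN ext[of _ "\<lambda>_. 0"]] by simp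
qed auto

section \<open>Affine fields in a flat chart\<close>

text \<open>The chart is \<open>T\<close>, the field \<open>P w\<close> is the one whose coordinates in the chart are the constant \<open>w\<close>,
  and \<open>\<eta>\<close> is the constant Gram form of the metric in the chart.\<close>

locale flat_chart =
  fixes T :: "'a::euclidean_space \<Rightarrow> 'a"
    and P :: "'a \<Rightarrow> 'a \<Rightarrow> 'a"
    and \<eta> :: "'a \<Rightarrow> 'a \<Rightarrow> real"
    and g :: "'a \<Rightarrow> 'a \<Rightarrow> 'a \<Rightarrow> real"
    and D :: "('a \<Rightarrow> 'a) \<Rightarrow> ('a \<Rightarrow> 'a) \<Rightarrow> 'a \<Rightarrow> 'a"
  assumes smooth_T: "smooth T"
    and smooth_P: "smooth (P w)"
    and dirderiv_P_T: "dirderiv (P w) T p = w"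
    and immersion: "frechet_derivative T (at p) u = 0 \<Longrightarrow> u = 0"
    and bilinear_form: "bounded_bilinear \<eta>"
    and form_commute: "\<eta> u v = \<eta> v u"
    and form_nondegenerate: "(\<And>v. \<eta> u v = 0) \<Longrightarrow> u = 0"
    and metric_chart: "g p u v = \<eta> (frechet_derivative T (at p) u) (frechet_derivative T (at p) v)"
    and levi_civita: "levi_civita g D"
begin

section \<open>The coordinate frame, the connection and affine fields in the chart\<close>

lemma chart_eqI:
  assumes "frechet_derivative T (at p) u = frechet_derivative T (at p) v"
  shows "u = v"
proof -
  have "u - v = 0"
    by (rule immersion[of p]) (simp add: assms linear_diff[OF linear_frechet_derivative[OF smooth_T]])
  then show ?thesis by simp
qed

text \<open>\<open>P\<close> is by assumption a right inverse of the derivative of \<open>T\<close>;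
  injectivity makes it a left inverse too, so every tangent vector at \<open>p\<close> is the value
  of some \<open>P w\<close>.\<close>

lemma P_frechet_derivative: "P (frechet_derivative T (at p) u) p = u"
  by (rule chart_eqI[of p]) (simp add: dirderiv_P_T[unfolded dirderiv_def])

lemma linear_P: "linear (\<lambda>w. P w p)"
proof (rule linearI)
  interpret linear "frechet_derivative T (at p)"
    by (rule linear_frechet_derivative[OF smooth_T])
  note PT = dirderiv_P_T[unfolded dirderiv_def]
  show "P (v + w) p = P v p + P w p" for v w
    by (rule chart_eqI[of p]) (simp add: add PT)
  show "P (r *\<^sub>R w) p = r *\<^sub>R P w p" for r w
    by (rule chart_eqI[of p]) (simp add: scale PT)
qed

lemma smooth_connection: "smooth X \<Longrightarrow> smooth Y \<Longrightarrow> smooth (D X Y)"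
  using levi_civita by (simp add: levi_civita_def affine_connection_def)

text \<open>This is uniqueness of the Levi-Civita connection, seen through \<open>T\<close>. The
  defect \<open>S\<close> is symmetric because \<open>D\<close> is torsion-free, and skew when
  paired by \<eta> because \<eta> is constant in the chart; both together force it to
  vanish.\<close>

lemma dirderiv_connection_chart:
  assumes "smooth Y" "smooth Z"
  shows "dirderiv (D Y Z) T = dirderiv Y (dirderiv Z T)"
proof
  fix p
  interpret \<eta>: bounded_bilinear \<eta> by (rule bilinear_form)
  define S where "S X Y = dirderiv (D X Y) T p - dirderiv X (dirderiv Y T) p" for X Y
  have S_commute: "S X Y = S Y X" if "smooth X" "smooth Y" for X Y
  proof -
    have "D X Y p - D Y X p = lie_bracket X Y p"
      using levi_civita that unfolding levi_civita_def torsion_free_def fun_eq_iff by blast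
    then have "dirderiv (D X Y) T p - dirderiv (D Y X) T p = dirderiv (lie_bracket X Y) T p"
      unfolding dirderiv_def by (metis linear_diff[OF linear_frechet_derivative[OF smooth_T]])
    then show ?thesis
      by (simp add: dirderiv_lie_bracket that smooth_T S_def algebra_simps)
  qed
  have S_skew: "\<eta> (S X Y) (dirderiv Z T p) = - \<eta> (S X Z) (dirderiv Y T p)"
    if "smooth X" "smooth Y" "smooth Z" for X Y Z
  proof -
    have "dirderiv X (\<lambda>p. g p (Y p) (Z p)) p = g p (D X Y p) (Z p) + g p (Y p) (D X Z p)"
      using levi_civita that unfolding levi_civita_def metric_compatible_def fun_eq_iff by blast
    moreover have "(\<lambda>p. g p (Y p) (Z p)) = (\<lambda>p. \<eta> (dirderiv Y T p) (dirderiv Z T p))"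
      by (simp add: metric_chart dirderiv_def)
    moreover have "dirderiv X (\<lambda>p. \<eta> (dirderiv Y T p) (dirderiv Z T p)) p =
        \<eta> (dirderiv Y T p) (dirderiv X (dirderiv Z T) p) + \<eta> (dirderiv X (dirderiv Y T) p) (dirderiv Z T p)"
      using frechet_derivative_at[OF \<eta>.FDERIV[OF
            smooth_has_derivative[OF smooth_dirderiv[OF that(2) smooth_T]]
            smooth_has_derivative[OF smooth_dirderiv[OF that(3) smooth_T]]], symmetric]
      by (simp add: dirderiv_def[of X])
    ultimately have "\<eta> (S X Y) (dirderiv Z T p) + \<eta> (dirderiv Y T p) (S X Z) = 0"
      by (simp add: metric_chart S_def \<eta>.diff_left \<eta>.diff_right)
        (simp add: dirderiv_def)
    then show ?thesis
      by (simp add: form_commute[of "dirderiv Y T p"])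
  qed
  have "\<eta> (S Y Z) w = 0" for w
  proof -
    note s = assms smooth_P[of w]
    \<comment> \<open>With \<open>B(X,Y,Z)\<close> for the pairing of \<open>S X Y\<close> with the
      image of \<open>Z\<close>, swapping the last two arguments changes the sign and swapping the
      first two does not. Hence \<open>B(Y,Z,W) = -B(Y,W,Z) = -B(W,Y,Z) = B(W,Z,Y) = B(Z,W,Y) =
      -B(Z,Y,W) = -B(Y,Z,W)\<close>.\<close>
    have "\<eta> (S Y Z) (dirderiv (P w) T p) = - \<eta> (S Y Z) (dirderiv (P w) T p)"
      using S_skew[OF s(1-3)] S_skew[OF s(2,1,3)] S_skew[OF s(3,1,2)]
        S_commute[OF s(1,2)] S_commute[OF s(1,3)] S_commute[OF s(2,3)]
      by simp
    then show ?thesis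
      by (simp add: dirderiv_P_T)
  qed
  then have "S Y Z = 0"
    by (rule form_nondegenerate)
  then show "dirderiv (D Y Z) T p = dirderiv Y (dirderiv Z T) p"
    by (simp add: S_def)
qed

text \<open>Apply the injective derivative of \<open>T\<close> to both sides of the affine equation.
  Expanding the brackets, both sides contain \<open>X (Y (Z T))\<close>, the terms
  \<open>Y (X (Z T))\<close> cancel, and what remains is the Hessian identity for \<psi>.\<close>

lemma affine_iff_hessian:
  assumes X: "smooth X"
  defines "\<psi> \<equiv> dirderiv X T"
  shows "affine_vector_field D X \<longleftrightarrow>
    (\<forall>Y Z. smooth Y \<longrightarrow> smooth Z \<longrightarrow> dirderiv (D Y Z) \<psi> = dirderiv Y (dirderiv Z \<psi>))"
proof -
  have "lie_bracket X (D Y Z) = (\<lambda>p. D (lie_bracket X Y) Z p + D Y (lie_bracket X Z) p) \<longleftrightarrow>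
      dirderiv (D Y Z) \<psi> = dirderiv Y (dirderiv Z \<psi>)" if Y: "smooth Y" and Z: "smooth Z" for Y Z
  proof -
    note s = X Y Z smooth_T smooth_dirderiv smooth_connection smooth_lie_bracket
    have "frechet_derivative T (at p) (lie_bracket X (D Y Z) p) =
        dirderiv X (dirderiv Y (dirderiv Z T)) p - dirderiv (D Y Z) \<psi> p" for p
      using dirderiv_lie_bracket[of X "D Y Z" T]
      by (simp add: s dirderiv_connection_chart \<psi>_def) (metis dirderiv_def)
    moreover have "frechet_derivative T (at p) (D (lie_bracket X Y) Z p + D Y (lie_bracket X Z) p) =
        dirderiv X (dirderiv Y (dirderiv Z T)) p - dirderiv Y (dirderiv Z \<psi>) p" for p
    proof -
      have "frechet_derivative T (at p) (D (lie_bracket X Y) Z p + D Y (lie_bracket X Z) p) =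
          dirderiv (D (lie_bracket X Y) Z) T p + dirderiv (D Y (lie_bracket X Z)) T p"
        by (simp add: dirderiv_def linear_add[OF linear_frechet_derivative[OF smooth_T]])
      also have "\<dots> = dirderiv (lie_bracket X Y) (dirderiv Z T) p
          + dirderiv Y (dirderiv (lie_bracket X Z) T) p"
        by (simp add: s dirderiv_connection_chart)
      finally show ?thesis
        by (simp add: s dirderiv_lie_bracket dirderiv_diff \<psi>_def)
    qed
    moreover have "lie_bracket X (D Y Z) p = D (lie_bracket X Y) Z p + D Y (lie_bracket X Z) p \<longleftrightarrow>
        frechet_derivative T (at p) (lie_bracket X (D Y Z) p) =
        frechet_derivative T (at p) (D (lie_bracket X Y) Z p + D Y (lie_bracket X Z) p)" for p
      using chart_eqI by metis
    ultimately show ?thesis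
      by (simp only: fun_eq_iff) simp
  qed
  then show ?thesis
    using X by (auto simp: affine_vector_field_def)
qed

theorem affine_iff_affine_in_chart:
  assumes X: "smooth X"
  shows "affine_vector_field D X \<longleftrightarrow> (\<exists>L c. linear L \<and> (\<forall>p. dirderiv X T p = L (T p) + c))"
proof
  define \<psi> where "\<psi> = dirderiv X T"
  have \<psi>: "smooth \<psi>"
    unfolding \<psi>_def by (intro smooth_dirderiv X smooth_T)
  assume "affine_vector_field D X"
  then have hess: "dirderiv (D Y Z) \<psi> = dirderiv Y (dirderiv Z \<psi>)" if "smooth Y" "smooth Z" for Y Z
    using affine_iff_hessian[OF X] that by (simp add: \<psi>_def)
  \<comment> \<open>The coordinate fields are parallel, because \<open>P w\<close> differentiates
    \<open>T\<close> to a constant.\<close>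
  have "D (P v) (P w) p = 0" for v w p
  proof (rule immersion[of p])
    have "dirderiv (D (P v) (P w)) T p = dirderiv (P v) (dirderiv (P w) T) p"
      by (simp add: dirderiv_connection_chart smooth_P)
    also have "dirderiv (P w) T = (\<lambda>p. w)"
      by (simp add: fun_eq_iff dirderiv_P_T)
    finally show "frechet_derivative T (at p) (D (P v) (P w) p) = 0"
      by (simp add: dirderiv_def)
  qed
  then have "dirderiv (P v) (dirderiv (P w) \<psi>) p = 0" for v w p
    using hess[OF smooth_P smooth_P, of v w] linear_0[OF linear_frechet_derivative[OF \<psi>]]
    by (metis dirderiv_def)
  \<comment> \<open>The vectors \<open>P v p\<close> exhaust the tangent space at \<open>p\<close>,
    so the derivative vanishes in every direction.\<close>
  then have "frechet_derivative (dirderiv (P w) \<psi>) (at p) u = 0" for w p u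
    using P_frechet_derivative[of p u] unfolding dirderiv_def[of "P _" "dirderiv _ _"] by metis
  then have const: "dirderiv (P w) \<psi> p = dirderiv (P w) \<psi> 0" for w p
    by (rule frechet_derivative_zero_constant[OF smooth_dirderiv[OF smooth_P \<psi>]])
  \<comment> \<open>\<open>L\<close> is the Jacobian of \<psi> in the chart; by \<open>const\<close>
    the base point \<open>0\<close> is as good as any other, and \<psi> differs from
    \<open>L\<close> after \<open>T\<close> by a constant.\<close>
  define L where "L w = dirderiv (P w) \<psi> 0" for w
  have L: "linear L"
    using linear_compose[OF linear_P linear_frechet_derivative[OF \<psi>], of 0 0]
    by (simp add: L_def[abs_def] dirderiv_def o_def)
  have "((\<lambda>p. \<psi> p - L (T p)) has_derivative (\<lambda>u. 0)) (at p)" for p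
  proof -
    have "frechet_derivative \<psi> (at p) u = L (frechet_derivative T (at p) u)" for u
      using const[of "frechet_derivative T (at p) u" p] P_frechet_derivative[of p u]
      by (simp add: L_def) (simp add: dirderiv_def)
    moreover have "((\<lambda>p. \<psi> p - L (T p)) has_derivative
        (\<lambda>u. frechet_derivative \<psi> (at p) u - L (frechet_derivative T (at p) u))) (at p)"
      using L by (intro has_derivative_diff smooth_has_derivative \<psi> smooth_T
          bounded_linear.has_derivative[of L]) (simp add: linear_conv_bounded_linear)
    ultimately show ?thesis by simp
  qed
  then obtain c where "\<And>p. \<psi> p - L (T p) = c"
    using has_derivative_zero_constant[of UNIV "\<lambda>p. \<psi> p - L (T p)"] by auto
  then show "\<exists>L c. linear L \<and> (\<forall>p. dirderiv X T p = L (T p) + c)"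
    using L by (metis \<psi>_def diff_add_cancel add.commute)
next
  assume "\<exists>L c. linear L \<and> (\<forall>p. dirderiv X T p = L (T p) + c)"
  then obtain L c where L: "linear L" and XT: "dirderiv X T = (\<lambda>p. L (T p) + c)"
    by auto
  have Lc: "dirderiv Z (\<lambda>p. L (f p) + c) p = L (dirderiv Z f p)" if "smooth f" for Z f :: "'a \<Rightarrow> 'a" and c p
    using frechet_derivative_at[OF has_derivative_add_const[OF bounded_linear.has_derivative[OF
          L[unfolded linear_conv_bounded_linear] smooth_has_derivative[OF that]]], symmetric]
    by (simp add: dirderiv_def)
  show "affine_vector_field D X"
    unfolding affine_iff_hessian[OF X] XT
  proof (intro allI impI ext)
    fix Y Z :: "'a \<Rightarrow> 'a" and p
    assume s: "smooth Y" "smooth Z"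
    \<comment> \<open>The added \<open>0\<close> keeps the shape required by \<open>Lc\<close>,
      which is used again for the outer derivatives.\<close>
    have "dirderiv Z (\<lambda>p. L (T p) + c) = (\<lambda>p. L (dirderiv Z T p) + 0)"
      by (simp add: fun_eq_iff Lc smooth_T)
    then show "dirderiv (D Y Z) (\<lambda>p. L (T p) + c) p = dirderiv Y (dirderiv Z (\<lambda>p. L (T p) + c)) p"
      by (simp only: Lc smooth_T smooth_dirderiv s dirderiv_connection_chart)
  qed
qed

end

section \<open>The flat chart of the Heisenberg group\<close>

lemma vector3_eq: "(vector [a, b, c] :: real^3) = a *\<^sub>R axis 1 1 + b *\<^sub>R axis 2 1 + c *\<^sub>R axis 3 1"
  by (simp add: vec_eq_iff forall_3 axis_def)

lemma smooth_vector3: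
  assumes "smooth a" "smooth b" "smooth c"
  shows "smooth (\<lambda>p. vector [a p, b p, c p] :: real^3)"
  unfolding vector3_eq
  by (intro smooth_add smooth_bilinear[OF bounded_bilinear_scaleR] smooth_const assms)

lemma smooth_vec_nth: "smooth (\<lambda>p::real^'n. p $ i)"
proof -
  have d: "((\<lambda>p::real^'n. p $ i) has_derivative (\<lambda>u. u $ i)) (at p)" for p
    by (intro bounded_linear_imp_has_derivative bounded_linear_vec_nth)
  have "nsmooth n (\<lambda>p::real^'n. p $ i)" for n
    using d by (cases n) (auto simp: frechet_derivative_at[OF d, symmetric] differentiable_def
        nsmooth_const intro!: continuous_intros)
  then show ?thesis by (simp add: smooth_def)
qed

lemma smooth_mult:
  fixes f g :: "'a::euclidean_space \<Rightarrow> real"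
  shows "smooth f \<Longrightarrow> smooth g \<Longrightarrow> smooth (\<lambda>p. f p * g p)"
  by (rule smooth_bilinear[OF bounded_bilinear_mult])

lemma smooth_power:
  fixes f :: "'a::euclidean_space \<Rightarrow> real"
  shows "smooth f \<Longrightarrow> smooth (\<lambda>p. f p ^ n)"
  by (induction n) (auto intro: smooth_const smooth_mult)

lemmas smooth_intros = smooth_vector3 smooth_vec_nth smooth_mult smooth_power smooth_add smooth_diff smooth_minus smooth_const

text \<open>The components are affine along the geodesics of \<open>christoffel3\<close>, which
  solve \<open>x'' = y'^2\<close>, \<open>y'' = 0\<close>, \<open>z'' = -2 x' y'\<close>. Factors
  such as \<open>1/2\<close> are written as products because \<open>smooth_intros\<close> has rules
  for products and constants.\<close>

definition flat3 :: "heisenberg \<Rightarrow> heisenberg" where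
  "flat3 p = vector [p$1 - 1/2 * (p$2)^2, p$2, p$3 + p$1 * p$2 - 1/6 * (p$2)^3]"

text \<open>The formula solves the triangular system that sets the derivative of
  \<open>flat3\<close> on an unknown vector equal to \<open>w\<close>.\<close>

definition flat_field3 :: "heisenberg \<Rightarrow> heisenberg \<Rightarrow> heisenberg" where
  "flat_field3 w p = vector [w$1 + w$2 * p$2, w$2, w$3 - w$2 * p$1 - w$1 * p$2 - w$2 * (1/2) * (p$2)^2]"

definition flat_form3 :: "heisenberg \<Rightarrow> heisenberg \<Rightarrow> real" where
  "flat_form3 u v = u$1 * v$1 - u$2 * v$2 + u$2 * v$3 + u$3 * v$2"

lemma frechet_derivative_flat3:
  "frechet_derivative flat3 (at p) u =
     vector [u$1 - p$2 * u$2, u$2, u$3 + p$1 * u$2 + p$2 * u$1 - (p$2)^2 / 2 * u$2]"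
proof -
  have d: "((\<lambda>q::heisenberg. q $ i) has_derivative (\<lambda>u. u $ i)) (at p)" for i
    by (intro bounded_linear_imp_has_derivative bounded_linear_vec_nth)
  have "(flat3 has_derivative (\<lambda>u. vector
      [u$1 - p$2 * u$2, u$2, u$3 + p$1 * u$2 + p$2 * u$1 - (p$2)^2 / 2 * u$2])) (at p)"
    unfolding flat3_def[abs_def] vector3_eq
    by (auto intro!: derivative_eq_intros d simp: power2_eq_square algebra_simps)
  from frechet_derivative_at[OF this, symmetric] show ?thesis by simp
qed

lemma flat_chart_g3:
  assumes "levi_civita g3 D"
  shows "flat_chart flat3 flat_field3 flat_form3 g3 D"
proof (rule flat_chart.intro)
  show "smooth flat3"
    unfolding flat3_def[abs_def] by (intro smooth_intros)
  show "smooth (flat_field3 w)" for w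
    unfolding flat_field3_def[abs_def] by (intro smooth_intros)
  show "dirderiv (flat_field3 w) flat3 p = w" for w p
    by (simp add: dirderiv_def frechet_derivative_flat3 flat_field3_def vec_eq_iff forall_3
        algebra_simps power2_eq_square)
  show "u = 0" if "frechet_derivative flat3 (at p) u = 0" for p u
    using that by (auto simp: frechet_derivative_flat3 vec_eq_iff forall_3)
  show "bounded_bilinear flat_form3"
    unfolding bilinear_conv_bounded_bilinear[symmetric] bilinear_def
    by (auto intro!: linearI simp: flat_form3_def algebra_simps)
  show "flat_form3 u v = flat_form3 v u" for u v
    by (simp add: flat_form3_def)
  \<comment> \<open>The three axes give \<open>u$1 = 0\<close>, \<open>u$3 = u$2\<close> and
    \<open>u$2 = 0\<close>.\<close>
  show "u = 0" if "\<And>v. flat_form3 u v = 0" for u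
    using that[of "axis 1 1"] that[of "axis 2 1"] that[of "axis 3 1"]
    by (simp add: flat_form3_def axis_def vec_eq_iff forall_3)
  show "g3 p u v = flat_form3 (frechet_derivative flat3 (at p) u) (frechet_derivative flat3 (at p) v)" for p u v
    by (simp add: flat_form3_def frechet_derivative_flat3 g3_def algebra_simps power2_eq_square)
qed fact

section \<open>Matrix entries, coordinates and comparison of coefficients\<close>

lemma linear_components3:
  fixes L :: "real^3 \<Rightarrow> real^3"
  assumes "linear L"
  shows "L u $ i = L (axis 1 1) $ i * u$1 + L (axis 2 1) $ i * u$2 + L (axis 3 1) $ i * u$3"
proof -
  have "u = u$1 *\<^sub>R axis 1 1 + u$2 *\<^sub>R axis 2 1 + u$3 *\<^sub>R axis 3 1"
    by (simp add: vec_eq_iff forall_3 axis_def)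
  then have "L u = u$1 *\<^sub>R L (axis 1 1) + u$2 *\<^sub>R L (axis 2 1) + u$3 *\<^sub>R L (axis 3 1)"
    by (metis linear_add[OF assms] linear_scale[OF assms])
  then show ?thesis by simp
qed

text \<open>Trades the quantifier over linear maps for nine real matrix entries, so that the chart
  criterion becomes a statement about real parameters.\<close>

lemma ex_linear3:
  fixes Q :: "(real^3 \<Rightarrow> real^3) \<Rightarrow> bool"
  shows "(\<exists>L. linear L \<and> Q L) \<longleftrightarrow> (\<exists>a11 a12 a13 a21 a22 a23 a31 a32 a33. Q (\<lambda>u. vector
     [a11 * u$1 + a12 * u$2 + a13 * u$3, a21 * u$1 + a22 * u$2 + a23 * u$3, a31 * u$1 + a32 * u$2 + a33 * u$3]))"
proof
  assume "\<exists>L. linear L \<and> Q L"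
  then obtain L where L: "linear L" "Q L" by blast
  have eq: "L = (\<lambda>u. vector
     [L (axis 1 1) $ 1 * u$1 + L (axis 2 1) $ 1 * u$2 + L (axis 3 1) $ 1 * u$3,
      L (axis 1 1) $ 2 * u$1 + L (axis 2 1) $ 2 * u$2 + L (axis 3 1) $ 2 * u$3,
      L (axis 1 1) $ 3 * u$1 + L (axis 2 1) $ 3 * u$2 + L (axis 3 1) $ 3 * u$3])"
    unfolding fun_eq_iff vec_eq_iff forall_3 vector_3 by (intro allI conjI; rule linear_components3[OF L(1)])
  \<comment> \<open>\<open>eq\<close> has \<open>L\<close> on both sides, so it is applied by a
    single substitution; unification then supplies the matrix entries.\<close>
  show "\<exists>a11 a12 a13 a21 a22 a23 a31 a32 a33. Q (\<lambda>u. vector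
     [a11 * u$1 + a12 * u$2 + a13 * u$3, a21 * u$1 + a22 * u$2 + a23 * u$3, a31 * u$1 + a32 * u$2 + a33 * u$3])"
    by (intro exI) (rule subst[of _ _ Q, OF eq L(2)])
next
  have "linear (\<lambda>u::real^3. vector [a11 * u$1 + a12 * u$2 + a13 * u$3, a21 * u$1 + a22 * u$2 + a23 * u$3,
      a31 * u$1 + a32 * u$2 + a33 * u$3] :: real^3)" for a11 a12 a13 a21 a22 a23 a31 a32 a33
    by (rule linearI) (simp_all add: vec_eq_iff forall_3 algebra_simps)
  then show "\<exists>L. linear L \<and> Q L" if "\<exists>a11 a12 a13 a21 a22 a23 a31 a32 a33. Q (\<lambda>u. vector
     [a11 * u$1 + a12 * u$2 + a13 * u$3, a21 * u$1 + a22 * u$2 + a23 * u$3, a31 * u$1 + a32 * u$2 + a33 * u$3])"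
    using that by blast
qed

text \<open>Solves for the frame coefficients of a field whose chart components are
  \<open>A1\<close>, \<open>A2\<close>, \<open>A3\<close>: the second equation gives the sum
  \<open>F2 + F3\<close>, then the first gives \<open>F1\<close> and the third gives
  \<open>F2\<close>.\<close>

lemma triangular_system3:
  fixes F1 F2 F3 :: real
  shows "F1 - y * (F2 + F3) = A1 \<and> F2 + F3 = A2 \<and> F2 + y * F1 - y^2 / 2 * (F2 + F3) = A3 \<longleftrightarrow>
    F1 = A1 + y * A2 \<and> F2 = A3 - y * A1 - y^2 / 2 * A2 \<and> F3 = A2 - A3 + y * A1 + y^2 / 2 * A2"
    (is "?l \<longleftrightarrow> ?r")
proof
  assume l: ?l
  then have S: "F2 + F3 = A2" by blast
  from l have F1: "F1 = A1 + y * A2"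
    unfolding S by linarith
  from l have "F2 = A3 - y * F1 + y^2 / 2 * A2"
    unfolding S by linarith
  then have "F2 = A3 - y * A1 - y^2 / 2 * A2"
    unfolding F1 by (simp add: field_simps power2_eq_square)
  then show ?r
    using F1 S by auto
next
  assume r: ?r
  then have S: "F2 + F3 = A2" by linarith
  show ?l
    unfolding S using r by (auto simp: field_simps power2_eq_square)
qed

lemma forall_vector3: "(\<forall>p::real^3. Q p) \<longleftrightarrow> (\<forall>x y z. Q (vector [x, y, z]))"
proof
  assume Q: "\<forall>x y z. Q (vector [x, y, z])"
  show "\<forall>p. Q p"
  proof
    fix p :: "real^3"
    have "p = vector [p$1, p$2, p$3]"
      by (simp add: vec_eq_iff forall_3)
    then show "Q p" using Q by metis
  qed
qed simp

lemma ex_vector3: "(\<exists>p::real^3. Q p) \<longleftrightarrow> (\<exists>x y z. Q (vector [x, y, z]))"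
  using forall_vector3[of "\<lambda>p. \<not> Q p"] by blast

theorem theorem3p9:
  fixes f1 f2 f3 :: "heisenberg \<Rightarrow> real"
    and D :: "(heisenberg \<Rightarrow> heisenberg) \<Rightarrow> (heisenberg \<Rightarrow> heisenberg) \<Rightarrow> heisenberg \<Rightarrow> heisenberg"
  assumes "levi_civita g3 D"
    and "smooth f1" and "smooth f2" and "smooth f3"
  shows "affine_vector_field D (\<lambda>p. f1 p *\<^sub>R e1 p + f2 p *\<^sub>R e2 p + f3 p *\<^sub>R e3 p) \<longleftrightarrow>
    (\<exists>c1 c2 c4 c5 c6 c7 c8 c9 c10 c11 c12 c13 :: real. \<forall>x y z :: real.
      f1 (vector [x, y, z]) =
        - (c1 / 6) * y^4 + (2 * c2 - 3 * c5) / 6 * y^3 + (2 * c1 * x + c4) / 2 * y^2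
        + (c1 * z + c5 * x + c6) * y + c2 * z + c7 * x + c8 \<and>
      f2 (vector [x, y, z]) =
        (- (c1 / 2) * y^2 - c2 * y + c9) * z
        + (- (c1 / 2) * y^3 - (c5 + c2) / 2 * y^2 + (c9 - c7) * y + c10) * x
        + c1 / 12 * y^5 + (3 * c5 - c2) / 12 * y^4
        + (3 * c7 - 3 * c4 - 2 * c9) / 12 * y^3
        + c11 / 2 * y^2 + c12 * y + c13 \<and>
      f3 (vector [x, y, z]) =
        (c1 / 2 * y^2 + c2 * y + c1 - c9) * z
        - c1 / 12 * y^5 - (3 * c5 - c2) / 12 * y^4
        + (- 3 * c7 + 3 * c4 + 2 * c9 - 2 * c1) / 12 * y^3
        + (c1 / 2 * y^3 + (c2 + c5) / 2 * y^2 + (c1 + c7 - c9) * y + c5 - c2 - c10) * x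
        + (c2 - c5 - c11) / 2 * y^2 + (c4 + c7 - 2 * c12) / 2 * y
        + c10 + c11 + 2 * c6 - c13)"
proof -
  let ?X = "\<lambda>p. f1 p *\<^sub>R e1 p + f2 p *\<^sub>R e2 p + f3 p *\<^sub>R e3 p"
  interpret flat_chart flat3 flat_field3 flat_form3 g3 D
    by (rule flat_chart_g3[OF assms(1)])
  have e: "smooth e1" "smooth e2" "smooth e3"
    unfolding e1_def[abs_def] e2_def[abs_def] e3_def[abs_def] by (intro smooth_intros)+
  have X: "smooth ?X"
    by (intro smooth_add smooth_bilinear[OF bounded_bilinear_scaleR] assms e)
  let ?p = "\<lambda>x y z. vector [x, y, z] :: heisenberg"
  \<comment> \<open>The \<open>a\<close>'s and \<open>k\<close>'s are the matrix and the translation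
    of the affine map; they act on the components of \<open>flat3\<close> at
    \<open>(x, y, z)\<close>.\<close>
  have chart: "affine_vector_field D ?X \<longleftrightarrow>
    (\<exists>a11 a12 a13 a21 a22 a23 a31 a32 a33 k1 k2 k3. \<forall>x y z.
      f1 (?p x y z) - y * (f2 (?p x y z) + f3 (?p x y z)) =
        a11 * (x - y^2 / 2) + a12 * y + a13 * (z + x * y - y^3 / 6) + k1 \<and>
      f2 (?p x y z) + f3 (?p x y z) =
        a21 * (x - y^2 / 2) + a22 * y + a23 * (z + x * y - y^3 / 6) + k2 \<and>
      f2 (?p x y z) + y * f1 (?p x y z) - y^2 / 2 * (f2 (?p x y z) + f3 (?p x y z)) =
        a31 * (x - y^2 / 2) + a32 * y + a33 * (z + x * y - y^3 / 6) + k3)"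
    (is "_ \<longleftrightarrow> (\<exists>a11 a12 a13 a21 a22 a23 a31 a32 a33 k1 k2 k3. ?A a11 a12 a13 a21 a22 a23 a31 a32 a33 k1 k2 k3)")
  proof -
    have "dirderiv ?X flat3 (?p x y z) = vector [f1 (?p x y z) - y * (f2 (?p x y z) + f3 (?p x y z)),
        f2 (?p x y z) + f3 (?p x y z),
        f2 (?p x y z) + y * f1 (?p x y z) - y^2 / 2 * (f2 (?p x y z) + f3 (?p x y z))]" for x y z
      by (simp add: dirderiv_def frechet_derivative_flat3 e1_def e2_def e3_def vec_eq_iff forall_3 algebra_simps)
    then show ?thesis
      \<comment> \<open>\<open>ex_simps\<close> moves \<open>linear L\<close> out of the scope of
        the translation, giving the shape that \<open>ex_linear3\<close> expects.\<close>
      unfolding affine_iff_affine_in_chart[OF X] ex_simps ex_linear3 ex_vector3 forall_vector3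
      by (simp add: vec_eq_iff forall_3 flat3_def)
  qed
  show ?thesis
    unfolding chart
  proof (rule iffI, goal_cases)
    case 1
    then obtain a11 a12 a13 a21 a22 a23 a31 a32 a33 k1 k2 k3 where
      A: "?A a11 a12 a13 a21 a22 a23 a31 a32 a33 k1 k2 k3"
      by blast
    \<comment> \<open>The witnesses come from comparing coefficients: those of \<open>yz\<close>,
      \<open>z\<close>, \<open>y^2\<close>, \<open>xy\<close>, \<open>y\<close>, \<open>x\<close>,
      \<open>1\<close> in \<open>f1\<close> give \<open>c1\<close>, \<open>c2\<close>,
      \<open>c4\<close> to \<open>c8\<close>, and those of \<open>z\<close>, \<open>x\<close>,
      \<open>y^2\<close>, \<open>y\<close>, \<open>1\<close> in \<open>f2\<close> give
      \<open>c9\<close> to \<open>c13\<close>. The formula for \<open>f3\<close> then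
      follows.\<close>
    show ?case
      by (rule exI[of _ a23], rule exI[of _ a13], rule exI[of _ "2 * a22 - a11"], rule exI[of _ "a21 + a13"],
          rule exI[of _ "k2 + a12"], rule exI[of _ a11], rule exI[of _ k1], rule exI[of _ a33],
          rule exI[of _ a31], rule exI[of _ "- k2 - 2 * a12 - a31"], rule exI[of _ "a32 - k1"],
          rule exI[of _ k3], use A[unfolded triangular_system3] in simp)
        (simp add: field_simps power2_eq_square power3_eq_cube power4_eq_xxxx power_numeral_reduce)
  next
    case 2
    then obtain c1 c2 c4 c5 c6 c7 c8 c9 c10 c11 c12 c13 where C: "\<forall>x y z.
      f1 (?p x y z) =
        - (c1 / 6) * y^4 + (2 * c2 - 3 * c5) / 6 * y^3 + (2 * c1 * x + c4) / 2 * y^2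
        + (c1 * z + c5 * x + c6) * y + c2 * z + c7 * x + c8 \<and>
      f2 (?p x y z) =
        (- (c1 / 2) * y^2 - c2 * y + c9) * z
        + (- (c1 / 2) * y^3 - (c5 + c2) / 2 * y^2 + (c9 - c7) * y + c10) * x
        + c1 / 12 * y^5 + (3 * c5 - c2) / 12 * y^4
        + (3 * c7 - 3 * c4 - 2 * c9) / 12 * y^3
        + c11 / 2 * y^2 + c12 * y + c13 \<and>
      f3 (?p x y z) =
        (c1 / 2 * y^2 + c2 * y + c1 - c9) * z
        - c1 / 12 * y^5 - (3 * c5 - c2) / 12 * y^4
        + (- 3 * c7 + 3 * c4 + 2 * c9 - 2 * c1) / 12 * y^3
        + (c1 / 2 * y^3 + (c2 + c5) / 2 * y^2 + (c1 + c7 - c9) * y + c5 - c2 - c10) * x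
        + (c2 - c5 - c11) / 2 * y^2 + (c4 + c7 - 2 * c12) / 2 * y
        + c10 + c11 + 2 * c6 - c13"
      by blast
    \<comment> \<open>This inverts the substitution of the other direction. In particular
      \<open>a12\<close> and \<open>k2\<close> solve \<open>a12 + k2 = c6\<close> and
      \<open>2 * a12 + k2 = - c10 - c11\<close>.\<close>
    have "?A c7 (- c6 - c10 - c11) c2 (c5 - c2) ((c4 + c7) / 2) c1 c10 (c12 + c8) c9
        c8 (c10 + c11 + 2 * c6) c13"
      unfolding triangular_system3 using C
      by simp (simp add: field_simps power2_eq_square power3_eq_cube power4_eq_xxxx power_numeral_reduce)
    then show ?case
      by blast
  qed
qed

end
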